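(* Let $p$ be a prime, $\mathbb{C}_p$ the completion of an algebraic closure of $\mathbb{Q}_p$, $k\in\mathbb{Z}$, $\lambda\in\mathbb{C}_p$ with $\lambda\neq0$, and $r\in\mathbb{N}$. Define the formal power series $$G(t)=\frac{\mathrm{Li}_{k}\left(1-(1+\lambda t)^{-\frac{1}{\lambda}}\right)}{(1+\lambda t)^{\frac{1}{\lambda}}-1},\qquad F(t)=\frac{(e^{t}-1)\,\mathrm{Li}_{k}\left(1-(1+\lambda t)^{-\frac{1}{\lambda}}\right)}{t\left((1+\lambda t)^{\frac{1}{\lambda}}-1\right)}.$$ Then for every polynomial $p(x)\in\mathbb{C}_p[x]$, $$\left\langle G(t)^r\,\middle|\,p(x)\right\rangle=\int_{\mathbb{Z}_p}\cdots\int_{\mathbb{Z}_p}\left.\left(F(t)^r p(x)\right)\right|_{x=x_1+\cdots+x_r}d\mu_0(x_1)\cdots d\mu_0(x_r),$$ and $$\left\langle F(t)^r\int_{\mathbb{Z}_p}\cdots\int_{\mathbb{Z}_p}e^{(x_1+\cdots+x_r)t}d\mu_0(x_1)\cdots d\mu_0(x_r)\,\middle|\,p(x)\right\rangle=\int_{\mathbb{Z}_p}\cdots\int_{\mathbb{Z}_p}\left.\left(F(t)^r p(x)\right)\right|_{x=x_1+\cdots+x_r}d\mu_0(x_1)\cdots d\mu_0(x_r).$$ In particular, for all $n\ge0$, $$\beta_{n,\lambda}^{(k,r)}=\left\langle F(t)^r\int_{\mathbb{Z}_p}\cdots\int_{\mathbb{Z}_p}e^{(x_1+\cdots+x_r)t}d\mu_0(x_1)\cdots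 d\mu_0(x_r)\,\middle|\,x^n\right\rangle.$$
   Context: $\mathrm{Li}_k(x)=\sum_{n\ge1}x^n/n^k$ is the polylogarithm. Power series are formal in $t$ over $\mathbb{C}_p$; $(1+\lambda t)^{1/\lambda}$ means $\exp\left(\frac1\lambda\log(1+\lambda t)\right)$. Umbral calculus: for $f(t)=\sum_k a_k\frac{t^k}{k!}$, the pairing with polynomials is $\langle f(t)\mid x^n\rangle=a_n$, extended linearly; $f(t)$ acts on polynomials as an operator via $t^kp(x)=\frac{d^k}{dx^k}p(x)$. The $p$-adic invariant integral is $\int_{\mathbb{Z}_p}f(y)\,d\mu_0(y)=\lim_{N\to\infty}p^{-N}\sum_{y=0}^{p^N-1}f(y)$. The expression $\left.(F(t)^rp(x))\right|_{x=x_1+\cdots+x_r}$ means: apply the operator $F(t)^r$ to $p(x)$ and substitute $x=x_1+\cdots+x_r$, then integrate iteratively. The series $\int\cdots\int e^{(x_1+\cdots+x_r)t}d\mu_0(x_1)\cdots d\mu_0(x_r)$ denotes $\left(\sum_{n\ge0}\left(\int_{\mathbb{Z}_p}y^nd\mu_0(y)\right)\frac{t^n}{n!}\right)^r$. The higher-order degenerate poly-Bernoulli polynomials are defined by $G(t)^re^{xt}=\sum_{n\ge0}\beta^{(k,r)}_{n,\lambda}(x)\frac{t^n}{n!}$, and $\beta^{(k,r)}_{n,\lambda}=\beta^{(k,r)}_{n,\lambda}(0)$. *)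

theory Defs
  imports Complex_Main
    "HOL-Computational_Algebra.Primes"
    "HOL-Computational_Algebra.Polynomial"
    "HOL-Computational_Algebra.Formal_Power_Series"
begin

section \<open>The field of \<open>p\<close>-adic complex numbers\<close>

definition padic_abs :: "nat \<Rightarrow> rat \<Rightarrow> real" where
  "padic_abs p q =
     (if q = 0 then 0
      else case quotient_of q of (a, b) \<Rightarrow>
        real p powi (int (multiplicity (int p) b) - int (multiplicity (int p) a)))"

definition nonarch_abs :: "('a::field \<Rightarrow> real) \<Rightarrow> bool" where
  "nonarch_abs v \<longleftrightarrow>
     (\<forall>x. 0 \<le> v x) \<and> (\<forall>x. v x = 0 \<longleftrightarrow> x = 0) \<and>
     (\<forall>x y. v (x * y) = v x * v y) \<and> (\<forall>x y. v (x + y) \<le> max (v x) (v y))"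

definition abs_tendsto :: "('a::field \<Rightarrow> real) \<Rightarrow> (nat \<Rightarrow> 'a) \<Rightarrow> 'a \<Rightarrow> bool" where
  "abs_tendsto v s L \<longleftrightarrow> (\<lambda>n. v (s n - L)) \<longlonglongrightarrow> 0"

definition abs_Cauchy :: "('a::field \<Rightarrow> real) \<Rightarrow> (nat \<Rightarrow> 'a) \<Rightarrow> bool" where
  "abs_Cauchy v s \<longleftrightarrow> (\<forall>e>0. \<exists>N. \<forall>m\<ge>N. \<forall>n\<ge>N. v (s m - s n) < e)"

definition abs_complete :: "('a::field \<Rightarrow> real) \<Rightarrow> bool" where
  "abs_complete v \<longleftrightarrow> (\<forall>s. abs_Cauchy v s \<longrightarrow> (\<exists>L. abs_tendsto v s L))"

definition abs_closure :: "('a::field \<Rightarrow> real) \<Rightarrow> 'a set \<Rightarrow> 'a set" where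
  "abs_closure v S = {x. \<exists>s. (\<forall>n. s n \<in> S) \<and> abs_tendsto v s x}"

definition algebraic_elements_over :: "'a::field set \<Rightarrow> 'a set" where
  "algebraic_elements_over K = {x. \<exists>f. f \<noteq> 0 \<and> (\<forall>i. coeff f i \<in> K) \<and> poly f x = 0}"

definition algebraically_closed_in :: "'a::field set \<Rightarrow> bool" where
  "algebraically_closed_in K \<longleftrightarrow>
     (\<forall>f. degree f > 0 \<and> (\<forall>i. coeff f i \<in> K) \<longrightarrow> (\<exists>x\<in>K. poly f x = 0))"

text \<open>
  In a complete field whose absolute value \<open>v\<close> extends the \<open>p\<close>-adic one on the rationals,
  the closure of the rationals is a completion of them, i.e. a copy of the \<open>p\<close>-adic numbers.
\<close>
definition padic_numbers :: "('a::field_char_0 \<Rightarrow> real) \<Rightarrow> 'a set" where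
  "padic_numbers v = abs_closure v \<rat>"

definition padic_algebraic_closure :: "('a::field_char_0 \<Rightarrow> real) \<Rightarrow> 'a set" where
  "padic_algebraic_closure v = algebraic_elements_over (padic_numbers v)"

text \<open>
  The type \<open>'a\<close> with the absolute value \<open>v\<close> is a completion of an algebraic closure of the
  \<open>p\<close>-adic numbers. This determines \<open>('a, v)\<close> up to isometric isomorphism.
\<close>
definition padic_complex_field :: "nat \<Rightarrow> ('a::field_char_0 \<Rightarrow> real) \<Rightarrow> bool" where
  "padic_complex_field p v \<longleftrightarrow>
     prime p \<and> nonarch_abs v \<and> (\<forall>q. v (of_rat q) = padic_abs p q) \<and>
     abs_complete v \<and>
     algebraically_closed_in (padic_algebraic_closure v) \<and>
     abs_closure v (padic_algebraic_closure v) = UNIV"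


section \<open>The \<open>p\<close>-adic invariant integral\<close>

text \<open>
  The integrand is a function on the \<open>p\<close>-adic integers; the limit only involves its values
  at natural numbers.
\<close>
definition has_padic_integral ::
    "nat \<Rightarrow> ('a::field_char_0 \<Rightarrow> real) \<Rightarrow> ('a \<Rightarrow> 'a) \<Rightarrow> 'a \<Rightarrow> bool" where
  "has_padic_integral p v f I \<longleftrightarrow>
     abs_tendsto v (\<lambda>N. (\<Sum>y<p ^ N. f (of_nat y)) / of_nat p ^ N) I"

definition padic_integral :: "nat \<Rightarrow> ('a::field_char_0 \<Rightarrow> real) \<Rightarrow> ('a \<Rightarrow> 'a) \<Rightarrow> 'a" where
  "padic_integral p v f = (THE I. has_padic_integral p v f I)"

text \<open>
  The \<open>r\<close>-fold iterated integral of a function of \<open>[x\<^sub>1, \<dots>, x\<^sub>r]\<close>; the innermost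
  integration is over \<open>x\<^sub>1\<close>, the outermost over \<open>x\<^sub>r\<close>.
\<close>
primrec padic_iterated_integral ::
    "nat \<Rightarrow> ('a::field_char_0 \<Rightarrow> real) \<Rightarrow> nat \<Rightarrow> ('a list \<Rightarrow> 'a) \<Rightarrow> 'a" where
  "padic_iterated_integral p v 0 h = h []"
| "padic_iterated_integral p v (Suc r) h =
     padic_integral p v (\<lambda>x. padic_iterated_integral p v r (\<lambda>xs. h (xs @ [x])))"

text \<open>The series \<open>\<integral> e\<^sup>y\<^sup>t d\<mu>\<^sub>0(y)\<close>, integrated coefficientwise in \<open>t\<close>.\<close>
definition padic_exp_integral :: "nat \<Rightarrow> ('a::field_char_0 \<Rightarrow> real) \<Rightarrow> 'a fps" where
  "padic_exp_integral p v = Abs_fps (\<lambda>n. padic_integral p v (\<lambda>y. y ^ n) / fact n)"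

definition padic_multi_exp_integral :: "nat \<Rightarrow> ('a::field_char_0 \<Rightarrow> real) \<Rightarrow> nat \<Rightarrow> 'a fps" where
  "padic_multi_exp_integral p v r = padic_exp_integral p v ^ r"


section \<open>Umbral calculus\<close>

text \<open>
  For \<open>f(t) = \<Sum> a\<^sub>k t\<^sup>k / k!\<close> one has \<open>a\<^sub>k = k! * fps_nth f k\<close>.
\<close>
definition umbral_pairing :: "'a::field_char_0 fps \<Rightarrow> 'a poly \<Rightarrow> 'a" where
  "umbral_pairing f q = (\<Sum>i\<le>degree q. coeff q i * (fact i * fps_nth f i))"

definition umbral_operator :: "'a::field_char_0 fps \<Rightarrow> 'a poly \<Rightarrow> 'a poly" where
  "umbral_operator f q = (\<Sum>i\<le>degree q. smult (fps_nth f i) ((pderiv ^^ i) q))"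


section \<open>Degenerate poly-Bernoulli polynomials\<close>

definition polylog_fps :: "int \<Rightarrow> 'a::field_char_0 fps" where
  "polylog_fps k = Abs_fps (\<lambda>n. if n = 0 then 0 else 1 / of_nat n powi k)"

text \<open>\<open>(1 + \<lambda>t)\<^sup>a = exp (a * log (1 + \<lambda>t))\<close>; note that \<open>fps_ln 1\<close> is \<open>log (1 + t)\<close>.\<close>
definition degenerate_power :: "'a::field_char_0 \<Rightarrow> 'a \<Rightarrow> 'a fps" where
  "degenerate_power lam a =
     fps_compose (fps_exp 1)
       (fps_const a * fps_compose (fps_ln 1) (fps_const lam * fps_X))"

definition polylog_numerator :: "int \<Rightarrow> 'a::field_char_0 \<Rightarrow> 'a fps" where
  "polylog_numerator k lam = fps_compose (polylog_fps k) (1 - degenerate_power lam (- 1 / lam))"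

text \<open>
  In both quotients numerator and denominator have the same order at \<open>t = 0\<close> (1 and 2,
  respectively), so that the division is exact.
\<close>
definition G_series :: "int \<Rightarrow> 'a::field_char_0 \<Rightarrow> 'a fps" where
  "G_series k lam = polylog_numerator k lam / (degenerate_power lam (1 / lam) - 1)"

definition F_series :: "int \<Rightarrow> 'a::field_char_0 \<Rightarrow> 'a fps" where
  "F_series k lam =
     ((fps_exp 1 - 1) * polylog_numerator k lam) /
     (fps_X * (degenerate_power lam (1 / lam) - 1))"

definition degenerate_poly_bernoulli ::
    "int \<Rightarrow> nat \<Rightarrow> 'a::field_char_0 \<Rightarrow> nat \<Rightarrow> 'a \<Rightarrow> 'a" where
  "degenerate_poly_bernoulli k r lam n x = fact n * fps_nth (G_series k lam ^ r * fps_exp x) n"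


section \<open>Well-definedness\<close>

lemma abs_tendsto_const: "nonarch_abs v \<Longrightarrow> abs_tendsto v (\<lambda>_. c) c"
  by (simp add: abs_tendsto_def nonarch_abs_def LIMSEQ_const_iff)

lemma abs_tendsto_add:
  assumes "nonarch_abs v" "abs_tendsto v s a" "abs_tendsto v t b"
  shows "abs_tendsto v (\<lambda>n. s n + t n) (a + b)"
proof -
  have nn: "0 \<le> v x" for x using assms(1) by (simp add: nonarch_abs_def)
  have "v (s n + t n - (a + b)) \<le> max (v (s n - a)) (v (t n - b))" for n
    unfolding add_diff_add using assms(1) unfolding nonarch_abs_def by blast
  then have le: "v (s n + t n - (a + b)) \<le> v (s n - a) + v (t n - b)" for n
    by (smt (verit) nn)
  have "(\<lambda>n. v (s n - a) + v (t n - b)) \<longlonglongrightarrow> 0"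
    using tendsto_add[OF assms(2,3)[unfolded abs_tendsto_def]] by simp
  from tendsto_sandwich[OF _ _ tendsto_const this] show ?thesis
    using nn le by (simp add: abs_tendsto_def)
qed

lemma abs_tendsto_cmult:
  assumes "nonarch_abs v" "abs_tendsto v s a"
  shows "abs_tendsto v (\<lambda>n. c * s n) (c * a)"
proof -
  have "v (c * s n - c * a) = v c * v (s n - a)" for n
    using assms(1) by (simp add: nonarch_abs_def flip: right_diff_distrib)
  then show ?thesis
    using tendsto_mult_right_zero[OF assms(2)[unfolded abs_tendsto_def], of "v c"]
    by (simp add: abs_tendsto_def)
qed

lemma abs_tendsto_sum:
  assumes "nonarch_abs v" "finite A" "\<And>i. i \<in> A \<Longrightarrow> abs_tendsto v (s i) (a i)"
  shows "abs_tendsto v (\<lambda>n. \<Sum>i\<in>A. s i n) (\<Sum>i\<in>A. a i)"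
  using assms(2,3)
  by (induction A rule: finite_induct)
     (auto intro: abs_tendsto_const abs_tendsto_add assms(1))

lemma abs_tendsto_unique:
  assumes "nonarch_abs v" "abs_tendsto v s a" "abs_tendsto v s b"
  shows "a = b"
proof -
  have "abs_tendsto v (\<lambda>n. s n + (- 1) * s n) (a + (- 1) * b)"
    by (intro abs_tendsto_add abs_tendsto_cmult assms)
  then have "(\<lambda>n::nat. v (b - a)) \<longlonglongrightarrow> 0" by (simp add: abs_tendsto_def)
  then have "v (b - a) = 0" by (simp add: LIMSEQ_const_iff)
  then show ?thesis using assms(1) by (simp add: nonarch_abs_def)
qed

lemma padic_integral_eq:
  assumes "nonarch_abs v" "has_padic_integral p v f I"
  shows "padic_integral p v f = I"
  unfolding padic_integral_def using assms
  by (blast intro: the_equality abs_tendsto_unique[OF assms(1)] dest: has_padic_integral_def[THEN iffD1])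

lemma padic_abs_p:
  assumes "padic_complex_field p v"
  shows "v (of_nat p) = 1 / p"
proof -
  have p: "prime p" and "\<And>q. v (of_rat q) = padic_abs p q"
    using assms by (auto simp: padic_complex_field_def)
  from this(2)[of "of_nat p"] have "v (of_nat p) = padic_abs p (of_nat p)" by simp
  moreover have "quotient_of (rat_of_nat p) = (int p, 1)"
    using quotient_of_int[of "int p"] by (simp add: Rat.of_int_def)
  moreover have "multiplicity (int p) (int p) = 1"
    using p by (intro multiplicity_self) auto
  ultimately show ?thesis
    using p by (auto simp: padic_abs_def power_int_minus field_simps)
qed

lemma abs_tendsto_p_power:
  assumes "padic_complex_field p v" "n > 0"
  shows "abs_tendsto v (\<lambda>N. (of_nat p ^ N) ^ n) 0"
proof -
  have m: "v (a * b) = v a * v b" and z: "v a = 0 \<longleftrightarrow> a = 0" for a b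
    using assms by (auto simp: nonarch_abs_def padic_complex_field_def)
  have "v 1 = 1" using m[of 1 1] z[of 1] by simp
  then have pw: "v (a ^ j) = v a ^ j" for a j by (induction j) (auto simp: m)
  have p: "p > 1" using assms prime_gt_1_nat by (auto simp: padic_complex_field_def)
  then have "(1 / real p) ^ n < 1" using assms(2) by (intro power_less_one_iff[THEN iffD2]) auto
  then have "(\<lambda>N. ((1 / real p) ^ n) ^ N) \<longlonglongrightarrow> 0"
    using p by (intro LIMSEQ_power_zero) auto
  moreover have "v ((of_nat p ^ N) ^ n) = ((1 / real p) ^ n) ^ N" for N
    by (simp only: pw padic_abs_p[OF assms(1)] power_mult[symmetric] mult.commute)
  ultimately show ?thesis by (simp add: abs_tendsto_def)
qed

lemma power_has_padic_integral:
  assumes "padic_complex_field p v"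
  shows "\<exists>I. has_padic_integral p v (\<lambda>y. y ^ n) I"
proof (induction n rule: less_induct)
  case (less n)
  have v: "nonarch_abs v" and p: "p > 0"
    using assms by (auto simp: padic_complex_field_def prime_gt_0_nat)
  define S :: "nat \<Rightarrow> nat \<Rightarrow> 'a" where "S j N = (\<Sum>y<p ^ N. of_nat y ^ j) / of_nat p ^ N" for j N
  obtain B where B: "\<And>j. j < n \<Longrightarrow> abs_tendsto v (S j) (B j)"
    using less.IH unfolding has_padic_integral_def S_def by metis
  have rec: "S n N = 1 / of_nat (Suc n) *
      ((of_nat p ^ N) ^ n + (- 1) * (\<Sum>j<n. of_nat (Suc n choose j) * S j N))" for N
  proof -
    let ?M = "p ^ N"
    have "of_nat ?M ^ Suc n = (\<Sum>y<?M. of_nat (Suc y) ^ Suc n - of_nat y ^ Suc n :: 'a)"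
      using sum_lessThan_telescope[of "\<lambda>y. of_nat y ^ Suc n :: 'a" ?M] by simp
    also have "\<dots> = (\<Sum>y<?M. \<Sum>j\<le>n. of_nat (Suc n choose j) * of_nat y ^ j)"
    proof (rule sum.cong)
      fix y
      have "of_nat (Suc y) ^ Suc n = (of_nat y + 1 :: 'a) ^ Suc n" by (simp add: add.commute)
      also have "\<dots> = (\<Sum>j\<le>Suc n. of_nat (Suc n choose j) * of_nat y ^ j)"
        by (simp only: binomial_ring power_one mult_1_right)
      finally show "of_nat (Suc y) ^ Suc n - of_nat y ^ Suc n =
          (\<Sum>j\<le>n. of_nat (Suc n choose j) * (of_nat y :: 'a) ^ j)"
        by (simp del: power_Suc binomial_Suc_Suc of_nat_Suc)
    qed simp
    also have "\<dots> = (\<Sum>j\<le>n. of_nat (Suc n choose j) * (of_nat ?M * S j N))"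
      using p by (subst sum.swap) (simp add: S_def flip: sum_distrib_left)
    also have "\<dots> = of_nat ?M * (\<Sum>j\<le>n. of_nat (Suc n choose j) * S j N)"
      by (simp add: sum_distrib_left mult.left_commute)
    finally have "of_nat ?M ^ n = (\<Sum>j\<le>n. of_nat (Suc n choose j) * S j N)"
      using p by simp
    also have "\<dots> = (\<Sum>j<n. of_nat (Suc n choose j) * S j N) + of_nat (Suc n) * S n N"
      by (simp add: lessThan_Suc_atMost[symmetric] del: binomial_Suc_Suc of_nat_Suc)
    finally show ?thesis by (simp add: field_simps del: of_nat_Suc)
  qed
  have "\<exists>c. abs_tendsto v (\<lambda>N. (of_nat p ^ N) ^ n) c"
    using abs_tendsto_p_power[OF assms, of n] abs_tendsto_const[OF v, of 1]
    by (cases "n = 0") auto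
  then obtain c where "abs_tendsto v (\<lambda>N. (of_nat p ^ N) ^ n) c" ..
  then have "abs_tendsto v (S n) (1 / of_nat (Suc n) *
      (c + (- 1) * (\<Sum>j<n. of_nat (Suc n choose j) * B j)))"
    unfolding rec by (intro abs_tendsto_cmult abs_tendsto_add abs_tendsto_sum v B) auto
  then show ?case unfolding has_padic_integral_def S_def by blast
qed

lemma poly_has_padic_integral:
  assumes "padic_complex_field p v"
  shows "has_padic_integral p v (poly q)
    (\<Sum>i\<le>degree q. coeff q i * padic_integral p v (\<lambda>y. y ^ i))"
proof -
  have v: "nonarch_abs v" using assms by (auto simp: padic_complex_field_def)
  have "has_padic_integral p v (\<lambda>y. y ^ i) (padic_integral p v (\<lambda>y. y ^ i))" for i
    using power_has_padic_integral[OF assms, of i] padic_integral_eq[OF v] by metis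
  then have *: "abs_tendsto v (\<lambda>N. \<Sum>i\<le>degree q.
      coeff q i * ((\<Sum>y<p ^ N. of_nat y ^ i) / of_nat p ^ N))
    (\<Sum>i\<le>degree q. coeff q i * padic_integral p v (\<lambda>y. y ^ i))"
    unfolding has_padic_integral_def by (intro abs_tendsto_sum abs_tendsto_cmult v) auto
  have "(\<Sum>y<p ^ N. poly q (of_nat y)) / of_nat p ^ N =
      (\<Sum>i\<le>degree q. coeff q i * ((\<Sum>y<p ^ N. of_nat y ^ i) / of_nat p ^ N))" for N
    by (simp add: poly_altdef sum_distrib_left sum_divide_distrib) (subst sum.swap, simp)
  with * show ?thesis by (simp add: has_padic_integral_def)
qed

text \<open>
  Each partial iterated integral of \<open>q(x\<^sub>1 + \<dots> + x\<^sub>r)\<close> is a polynomial in the remaining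
  variables, so by the previous lemma all limits occurring in it exist.
\<close>
lemma padic_iterated_integral_poly:
  fixes v :: "'a::field_char_0 \<Rightarrow> real"
  assumes "padic_complex_field p v"
  shows "\<exists>R. \<forall>a. padic_iterated_integral p v r (\<lambda>xs. poly q (sum_list xs + a)) = poly R a"
proof (induction r)
  case 0
  then show ?case by auto
next
  case (Suc r)
  have v: "nonarch_abs v" using assms by (auto simp: padic_complex_field_def)
  from Suc obtain R where
    R: "\<And>a. padic_iterated_integral p v r (\<lambda>xs. poly q (sum_list xs + a)) = poly R a" by blast
  have shift: "padic_iterated_integral p v (Suc r) (\<lambda>xs. poly q (sum_list xs + a)) =
      padic_integral p v (poly (pcompose R [:a, 1:]))" for a
  proof -
    have "(\<lambda>x. padic_iterated_integral p v r (\<lambda>xs. poly q (sum_list (xs @ [x]) + a))) =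
        poly (pcompose R [:a, 1:])"
      using R[of "x + a" for x] by (simp add: fun_eq_iff poly_pcompose add.assoc add.commute[of a])
    then show ?thesis by simp
  qed
  define J where "J = (\<lambda>i. padic_integral p v (\<lambda>y. y ^ i))"
  have deg: "degree (pcompose R [:a, 1:]) = degree R" for a
    by (simp add: degree_pcompose)
  have "\<exists>C. \<forall>a i. coeff (pcompose R [:a, 1:]) i = poly (C i) a"
  proof (induction R)
    case 0
    show ?case by (rule exI[of _ "\<lambda>_. 0"]) simp
  next
    case (pCons b R)
    then obtain C where C: "\<And>a i. coeff (pcompose R [:a, 1:]) i = poly (C i) a" by blast
    show ?case
      by (rule exI[of _ "\<lambda>i. (case i of 0 \<Rightarrow> [:b:] + [:0, 1:] * C 0
                                | Suc j \<Rightarrow> [:0, 1:] * C i + C j)"])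
         (auto simp: pcompose_pCons C coeff_pCons split: nat.split)
  qed
  then obtain C where C: "\<And>a i. coeff (pcompose R [:a, 1:]) i = poly (C i) a" by blast
  have "padic_integral p v (poly (pcompose R [:a, 1:])) =
      poly (\<Sum>i\<le>degree R. smult (J i) (C i)) a" for a
    using padic_integral_eq[OF v poly_has_padic_integral[OF assms]]
    by (simp add: deg C poly_sum J_def mult.commute)
  then show ?case using shift by metis
qed

end

theory Submission
  imports Defs
begin

text \<open>
  Write \<open>E(t) = \<integral> e\<^sup>y\<^sup>t d\<mu>\<^sub>0(y)\<close>. The integral of a polynomial \<open>q\<close> is the pairing of \<open>E(t)\<close>
  with \<open>q\<close>. As translations are the operators \<open>e\<^sup>a\<^sup>t\<close>, the integral of \<open>q(x + a)\<close> over \<open>x\<close> is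
  therefore the value at \<open>a\<close> of the operator \<open>E(t)\<close> applied to \<open>q\<close>, and the \<open>r\<close>-fold integral
  of \<open>q(x\<^sub>1 + \<dots> + x\<^sub>r)\<close> is the pairing of \<open>E(t)\<^sup>r\<close> with \<open>q\<close>. In the same way, the shift
  equation \<open>\<integral> q(x + 1) d\<mu>\<^sub>0(x) = \<integral> q(x) d\<mu>\<^sub>0(x) + q'(0)\<close> says that \<open>(e\<^sup>t - 1) E(t) = t\<close>.
  Together with \<open>t F(t) = (e\<^sup>t - 1) G(t)\<close> this gives \<open>F(t) E(t) = G(t)\<close>.
\<close>

section \<open>Translations and higher derivatives of polynomials\<close>

lemma higher_pderiv_eq_0: "degree q < i \<Longrightarrow> (pderiv ^^ i) q = 0"
  by (intro poly_eqI) (simp add: coeff_higher_pderiv coeff_eq_0)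

lemma poly_higher_pderiv_0: "poly ((pderiv ^^ i) q) 0 = fact i * coeff q i"
  by (simp add: poly_0_coeff_0 coeff_higher_pderiv pochhammer_fact)

lemma higher_pderiv_pcompose_translate:
  fixes q :: "'a::idom poly"
  shows "(pderiv ^^ i) (q \<circ>\<^sub>p [:a, 1:]) = (pderiv ^^ i) q \<circ>\<^sub>p [:a, 1:]"
  by (induction i) (simp_all add: pderiv_pcompose pderiv_pCons)

lemma coeff_pcompose_translate:
  fixes q :: "'a::field_char_0 poly"
  shows "coeff (q \<circ>\<^sub>p [:a, 1:]) i = poly ((pderiv ^^ i) q) a / fact i"
  using poly_higher_pderiv_0[of i "q \<circ>\<^sub>p [:a, 1:]"]
  by (simp add: higher_pderiv_pcompose_translate poly_pcompose field_simps)

lemma poly_taylor: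
  fixes q :: "'a::field_char_0 poly"
  shows "poly q (a + x) = (\<Sum>i\<le>degree q. poly ((pderiv ^^ i) q) a / fact i * x ^ i)"
proof -
  have "poly q (a + x) = poly (q \<circ>\<^sub>p [:a, 1:]) x"
    by (simp add: poly_pcompose)
  also have "\<dots> = (\<Sum>i\<le>degree q. coeff (q \<circ>\<^sub>p [:a, 1:]) i * x ^ i)"
    by (simp add: poly_altdef degree_pcompose)
  finally show ?thesis by (simp only: coeff_pcompose_translate)
qed

lemma smult_sum_right: "smult c (\<Sum>i\<in>A. f i) = (\<Sum>i\<in>A. smult c (f i))"
  by (induction A rule: infinite_finite_induct) (simp_all add: smult_add_right)


section \<open>Umbral calculus\<close>

lemma umbral_operator_eq_sum:
  assumes "degree q \<le> N"
  shows "umbral_operator f q = (\<Sum>i\<le>N. smult (fps_nth f i) ((pderiv ^^ i) q))"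
  unfolding umbral_operator_def
  by (rule sum.mono_neutral_left) (use assms in \<open>auto simp: higher_pderiv_eq_0 not_le\<close>)

lemma degree_umbral_operator_le: "degree (umbral_operator f q) \<le> degree q"
  unfolding umbral_operator_def by (intro degree_sum_le) (auto simp: degree_higher_pderiv)

lemma umbral_operator_1: "umbral_operator 1 q = q"
  by (simp add: umbral_operator_def sum.atMost_shift)

lemma umbral_operator_fps_X: "umbral_operator fps_X q = pderiv q"
proof -
  have "umbral_operator fps_X q =
      (\<Sum>i\<le>Suc (degree q). smult (fps_nth fps_X i) ((pderiv ^^ i) q))"
    by (simp only: umbral_operator_eq_sum[OF le_SucI[OF order_refl]])
  also have "\<dots> = (\<Sum>i\<in>{1}. smult (fps_nth fps_X i) ((pderiv ^^ i) q))"
    by (rule sum.mono_neutral_right) auto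
  finally show ?thesis by simp
qed

lemma umbral_operator_mult:
  "umbral_operator (f * g) q = umbral_operator f (umbral_operator g q)"
proof -
  let ?N = "degree q"
  let ?T = "\<lambda>i j. smult (fps_nth f i * fps_nth g j) ((pderiv ^^ (i + j)) q)"
  have "umbral_operator f (umbral_operator g q) =
      (\<Sum>i\<le>?N. smult (fps_nth f i) ((pderiv ^^ i) (umbral_operator g q)))"
    by (rule umbral_operator_eq_sum[OF degree_umbral_operator_le])
  also have "\<dots> = (\<Sum>i\<le>?N. \<Sum>j\<le>?N. ?T i j)"
    by (simp add: umbral_operator_def higher_pderiv_sum higher_pderiv_smult smult_sum_right
        funpow_add)
  also have "\<dots> = (\<Sum>(i, j)\<in>{..?N} \<times> {..?N}. ?T i j)"
    by (simp add: sum.cartesian_product)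
  also have "\<dots> = (\<Sum>(i, j)\<in>{(i, j). i + j \<le> ?N}. ?T i j)"
    by (rule sum.mono_neutral_right) (auto intro: higher_pderiv_eq_0 simp flip: not_less)
  also have "\<dots> = (\<Sum>m\<le>?N. \<Sum>i\<le>m. ?T i (m - i))"
    by (rule sum.triangle_reindex_eq)
  also have "\<dots> = umbral_operator (f * g) q"
    by (simp add: umbral_operator_def fps_mult_nth atLeast0AtMost smult_sum)
  finally show ?thesis by simp
qed

lemma poly_umbral_operator_fps_exp: "poly (umbral_operator (fps_exp c) q) a = poly q (a + c)"
  by (simp add: poly_taylor umbral_operator_def poly_sum mult_ac)

lemma umbral_pairing_eq_poly_umbral_operator_0:
  "umbral_pairing f q = poly (umbral_operator f q) 0"
  by (simp add: umbral_pairing_def umbral_operator_def poly_sum poly_higher_pderiv_0 mult_ac)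

lemma umbral_pairing_mult: "umbral_pairing (f * g) q = umbral_pairing f (umbral_operator g q)"
  by (simp add: umbral_pairing_eq_poly_umbral_operator_0 umbral_operator_mult)

lemma umbral_pairing_mult_fps_exp:
  "umbral_pairing (f * fps_exp a) q = poly (umbral_operator f q) a"
  by (simp add: umbral_pairing_eq_poly_umbral_operator_0 mult.commute[of f] umbral_operator_mult
      poly_umbral_operator_fps_exp)

lemma umbral_pairing_fps_X: "umbral_pairing fps_X q = poly (pderiv q) 0"
  by (simp add: umbral_pairing_eq_poly_umbral_operator_0 umbral_operator_fps_X)

lemma umbral_pairing_diff: "umbral_pairing (f - g) q = umbral_pairing f q - umbral_pairing g q"
  by (simp add: umbral_pairing_def algebra_simps flip: sum_subtractf)

lemma umbral_pairing_monom: "umbral_pairing f (monom 1 n) = fact n * fps_nth f n"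
proof -
  have "umbral_pairing f (monom 1 n) = (\<Sum>i\<le>n. if i = n then fact i * fps_nth f i else 0)"
    unfolding umbral_pairing_def by (rule sum.cong) (auto simp: degree_monom_eq)
  then show ?thesis by simp
qed

lemma fps_eqI_umbral_pairing:
  assumes "\<And>q. umbral_pairing f q = umbral_pairing g q"
  shows "f = g"
  using assms[of "monom 1 n" for n] by (simp add: fps_eq_iff umbral_pairing_monom)


section \<open>The invariant integral of polynomials\<close>

lemma padic_complex_field_imp_nonarch_abs: "padic_complex_field p v \<Longrightarrow> nonarch_abs v"
  by (simp add: padic_complex_field_def)

lemma poly_has_padic_integral_umbral_pairing:
  assumes "padic_complex_field p v"
  shows "has_padic_integral p v (poly q) (umbral_pairing (padic_exp_integral p v) q)"
  using poly_has_padic_integral[OF assms, of q]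
  by (simp add: umbral_pairing_def padic_exp_integral_def)

lemma padic_integral_poly:
  assumes "padic_complex_field p v"
  shows "padic_integral p v (poly q) = umbral_pairing (padic_exp_integral p v) q"
  by (rule padic_integral_eq[OF padic_complex_field_imp_nonarch_abs[OF assms]
        poly_has_padic_integral_umbral_pairing[OF assms]])

lemma padic_integral_poly_translate:
  assumes "padic_complex_field p v"
  shows "padic_integral p v (\<lambda>x. poly q (x + a)) =
    poly (umbral_operator (padic_exp_integral p v) q) a"
proof -
  have "padic_integral p v (\<lambda>x. poly q (x + a)) =
      padic_integral p v (poly (umbral_operator (fps_exp a) q))"
    by (simp add: poly_umbral_operator_fps_exp[abs_def])
  also have "\<dots> = umbral_pairing (padic_exp_integral p v * fps_exp a) q"
    by (simp add: padic_integral_poly[OF assms] umbral_pairing_mult)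
  finally show ?thesis by (simp add: umbral_pairing_mult_fps_exp)
qed

lemma padic_iterated_integral_poly_translate:
  assumes "padic_complex_field p v"
  shows "padic_iterated_integral p v r (\<lambda>xs. poly q (sum_list xs + a)) =
    poly (umbral_operator (padic_multi_exp_integral p v r) q) a"
proof (induction r arbitrary: a)
  case 0
  show ?case by (simp add: padic_multi_exp_integral_def umbral_operator_1)
next
  case (Suc r)
  have "padic_iterated_integral p v (Suc r) (\<lambda>xs. poly q (sum_list xs + a)) =
      padic_integral p v
        (\<lambda>x. padic_iterated_integral p v r (\<lambda>xs. poly q (sum_list xs + (x + a))))"
    by (simp add: add.assoc)
  also have "\<dots> = padic_integral p v
      (\<lambda>x. poly (umbral_operator (padic_multi_exp_integral p v r) q) (x + a))"
    by (simp only: Suc.IH)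
  also have "\<dots> = poly (umbral_operator (padic_multi_exp_integral p v (Suc r)) q) a"
    by (simp add: padic_integral_poly_translate[OF assms] padic_multi_exp_integral_def
        umbral_operator_mult)
  finally show ?case .
qed

lemma umbral_pairing_mult_padic_multi_exp_integral:
  assumes "padic_complex_field p v"
  shows "umbral_pairing (f * padic_multi_exp_integral p v r) q =
    padic_iterated_integral p v r (\<lambda>xs. poly (umbral_operator f q) (sum_list xs))"
  using padic_iterated_integral_poly_translate[OF assms, of r "umbral_operator f q" 0]
  by (simp add: umbral_pairing_eq_poly_umbral_operator_0 mult.commute[of f] umbral_operator_mult)


section \<open>The shift equation of the invariant integral\<close>

lemma has_padic_integral_shift:
  assumes v: "nonarch_abs v"
    and integral: "has_padic_integral p v f I"
    and quotient: "abs_tendsto v (\<lambda>N. (f (of_nat p ^ N) - f 0) / of_nat p ^ N) D"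
  shows "has_padic_integral p v (\<lambda>x. f (x + 1)) (I + D)"
proof -
  have "(\<Sum>y<p ^ N. f (of_nat y + 1)) = (\<Sum>y<p ^ N. f (of_nat y)) + (f (of_nat p ^ N) - f 0)"
    for N
    using sum_lessThan_telescope[of "\<lambda>y. f (of_nat y)" "p ^ N"]
    by (simp add: sum_subtractf algebra_simps)
  then show ?thesis
    using abs_tendsto_add[OF v integral[unfolded has_padic_integral_def] quotient]
    by (simp add: has_padic_integral_def add_divide_distrib)
qed

lemma abs_tendsto_poly_p_power:
  assumes "padic_complex_field p v"
  shows "abs_tendsto v (\<lambda>N. poly q (of_nat p ^ N)) (poly q 0)"
proof -
  have v: "nonarch_abs v"
    by (rule padic_complex_field_imp_nonarch_abs[OF assms])
  have "abs_tendsto v (\<lambda>N. (of_nat p ^ N) ^ i) (0 ^ i)" for i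
    using abs_tendsto_p_power[OF assms, of i] abs_tendsto_const[OF v, of 1]
    by (cases "i = 0") (auto simp: zero_power)
  then show ?thesis
    unfolding poly_altdef by (intro abs_tendsto_sum abs_tendsto_cmult v) auto
qed

lemma abs_tendsto_poly_difference_quotient_p_power:
  assumes "padic_complex_field p v"
  shows "abs_tendsto v (\<lambda>N. (poly q (of_nat p ^ N) - poly q 0) / of_nat p ^ N)
    (poly (pderiv q) 0)"
proof (cases q)
  case (pCons c q')
  have "p > 0" using assms by (simp add: padic_complex_field_def prime_gt_0_nat)
  then show ?thesis
    using abs_tendsto_poly_p_power[OF assms, of q'] by (simp add: pCons pderiv_pCons)
qed

lemma padic_integral_poly_shift:
  assumes "padic_complex_field p v"
  shows "padic_integral p v (\<lambda>x. poly q (x + 1)) =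
    padic_integral p v (poly q) + poly (pderiv q) 0"
proof -
  have v: "nonarch_abs v"
    by (rule padic_complex_field_imp_nonarch_abs[OF assms])
  show ?thesis
    unfolding padic_integral_poly[OF assms]
    by (intro padic_integral_eq[OF v] has_padic_integral_shift[OF v]
        poly_has_padic_integral_umbral_pairing abs_tendsto_poly_difference_quotient_p_power assms)
qed

lemma exp_minus_1_mult_padic_exp_integral:
  assumes "padic_complex_field p v"
  shows "(fps_exp 1 - 1) * padic_exp_integral p v = fps_X"
proof (rule fps_eqI_umbral_pairing)
  fix q
  let ?E = "padic_exp_integral p v"
  have "umbral_pairing ((fps_exp 1 - 1) * ?E) q =
      umbral_pairing (?E * fps_exp 1) q - umbral_pairing ?E q"
    by (simp add: left_diff_distrib umbral_pairing_diff mult.commute[of ?E])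
  also have "\<dots> = padic_integral p v (\<lambda>x. poly q (x + 1)) - padic_integral p v (poly q)"
    by (simp add: padic_integral_poly_translate[OF assms] padic_integral_poly[OF assms]
        umbral_pairing_mult_fps_exp)
  also have "\<dots> = umbral_pairing fps_X q"
    by (simp add: padic_integral_poly_shift[OF assms] umbral_pairing_fps_X)
  finally show "umbral_pairing ((fps_exp 1 - 1) * ?E) q = umbral_pairing fps_X q" .
qed


section \<open>Degenerate poly-Bernoulli series\<close>

lemma degenerate_power_nth_0: "fps_nth (degenerate_power lam a) 0 = 1"
  by (simp add: degenerate_power_def)

lemma degenerate_power_nth_1: "fps_nth (degenerate_power lam a) 1 = a * lam"
  by (simp add: degenerate_power_def fps_compose_nth fps_ln_def)

lemma subdegree_degenerate_power_minus_1:
  assumes "lam \<noteq> 0" and "a \<noteq> 0"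
  shows "subdegree (degenerate_power lam a - 1) = 1"
  using assms degenerate_power_nth_1[of lam a]
  by (intro subdegreeI) (auto simp: degenerate_power_nth_0)

lemma polylog_numerator_nth_0: "fps_nth (polylog_numerator k lam) 0 = 0"
  by (simp add: polylog_numerator_def polylog_fps_def)

lemma fps_dvd_if_subdegree_1:
  fixes f g :: "'a::field fps"
  assumes "subdegree f = 1" and "fps_nth g 0 = 0"
  shows "f dvd g"
proof (cases "g = 0")
  case False
  then have "subdegree g \<ge> 1"
    using assms(2) by (intro subdegree_geI) auto
  moreover have "f \<noteq> 0"
    using assms(1) by auto
  ultimately show ?thesis
    using False assms(1) by (simp add: fps_dvd_iff)
qed simp

lemma fps_X_mult_F_series:
  fixes lam :: "'a::field_char_0"
  assumes "lam \<noteq> 0"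
  shows "fps_X * F_series k lam = (fps_exp 1 - 1) * G_series k lam"
proof -
  define D where "D = degenerate_power lam (1 / lam) - 1"
  define L where "L = polylog_numerator k lam"
  have "subdegree D = 1"
    unfolding D_def using assms by (intro subdegree_degenerate_power_minus_1) auto
  then have "D dvd L" and "D \<noteq> 0"
    by (auto simp: L_def polylog_numerator_nth_0 intro: fps_dvd_if_subdegree_1)
  have "fps_X dvd (fps_exp 1 - 1 :: 'a fps)"
    by (simp add: fps_dvd_if_subdegree_1)
  then have "F_series k lam * (fps_X * D) = (fps_exp 1 - 1) * L"
    using \<open>D dvd L\<close> by (simp add: F_series_def D_def L_def mult_dvd_mono)
  also have "L = G_series k lam * D"
    using \<open>D dvd L\<close> by (simp add: G_series_def D_def L_def)
  finally have "(fps_X * F_series k lam) * D = ((fps_exp 1 - 1) * G_series k lam) * D"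
    by (simp only: mult_ac)
  with \<open>D \<noteq> 0\<close> show ?thesis by simp
qed

lemma F_series_mult_padic_exp_integral:
  assumes "padic_complex_field p v" and "lam \<noteq> 0"
  shows "F_series k lam * padic_exp_integral p v = G_series k lam"
proof -
  let ?E = "padic_exp_integral p v"
  have "fps_X * (F_series k lam * ?E) = ((fps_exp 1 - 1) * ?E) * G_series k lam"
    by (simp only: mult.assoc[symmetric] fps_X_mult_F_series[OF assms(2)]) (simp only: mult_ac)
  also have "\<dots> = fps_X * G_series k lam"
    by (simp only: exp_minus_1_mult_padic_exp_integral[OF assms(1)])
  finally show ?thesis by simp
qed

lemma degenerate_poly_bernoulli_eq_umbral_pairing:
  "degenerate_poly_bernoulli k r lam n x =
    umbral_pairing (G_series k lam ^ r * fps_exp x) (monom 1 n)"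
  by (simp add: degenerate_poly_bernoulli_def umbral_pairing_monom)

theorem theorem4:
  fixes p :: nat and v :: "'a::field_char_0 \<Rightarrow> real"
    and k :: int and lam :: 'a and r :: nat
  assumes "padic_complex_field p v"
    and "lam \<noteq> 0"
  shows "(\<forall>q :: 'a poly.
            umbral_pairing (G_series k lam ^ r) q =
            padic_iterated_integral p v r
              (\<lambda>xs. poly (umbral_operator (F_series k lam ^ r) q) (sum_list xs))) \<and>
         (\<forall>q :: 'a poly.
            umbral_pairing (F_series k lam ^ r * padic_multi_exp_integral p v r) q =
            padic_iterated_integral p v r
              (\<lambda>xs. poly (umbral_operator (F_series k lam ^ r) q) (sum_list xs))) \<and>
         (\<forall>n :: nat.
            degenerate_poly_bernoulli k r lam n 0 =
            umbral_pairing (F_series k lam ^ r * padic_multi_exp_integral p v r) (monom 1 n))"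
proof -
  have "F_series k lam ^ r * padic_multi_exp_integral p v r = G_series k lam ^ r"
    by (simp add: padic_multi_exp_integral_def F_series_mult_padic_exp_integral[OF assms]
        flip: power_mult_distrib)
  then show ?thesis
    using umbral_pairing_mult_padic_multi_exp_integral[OF assms(1), of "F_series k lam ^ r" r]
    by (simp add: degenerate_poly_bernoulli_eq_umbral_pairing)
qed

end
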